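(* Let $\rho\ge 0$, let $p,q\in[1,\infty]$ with $\frac1p+\frac1q=1$, and let $\phi,\psi,\chi:\mathbb{R}\to\mathbb{C}$ be measurable with $(1+|z|^\rho)\phi(z)\in L^p(\mathbb{R})$, $\chi\in L^q(\mathbb{R})$ and $(1+|z|^\rho)\psi(z)\in L^1(\mathbb{R})$, where $\phi\in L^2(\mathbb{R})$ satisfies $0<C_\phi=\int_{\mathbb{R}}\frac{|\hat\phi(\omega)|^2}{|\omega|}\,d\omega<\infty$. Then for all $u,v,w\in\mathbb{R}$ with $v\ne w$ and $u\neq w$, $$|D^\alpha(u,v,w)|\le 2^{\rho+\frac1p}\,C_\phi^{-1}\,|v-w|^{-\frac1q}\,|u-w|^{-\frac1p-\rho}\,\|\chi\|_q\,\big\|(1+|z|^\rho)\phi(z)\big\|_p\,\big\|(1+|z|^\rho)\psi(z)\big\|_1 .$$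
   Context: Let $\theta=\alpha\pi/2$ with $\sin\theta\ne 0$. For a function $f$ on $\mathbb{R}$ (with $f=\phi,\psi,\chi$), $a\in\mathbb{R}\setminus\{0\}$, $b\in\mathbb{R}$, put $$f^{\alpha}_{a,b}(t)=e^{-\frac{i}{2}(t^2-b^2)\cot\theta}\,|a|^{-\rho}\,f\!\left(\frac{t-b}{a}\right).$$ The basic function associated with $(\phi,\psi,\chi)$ is $$D^\alpha(u,v,w)=C_\phi^{-1}\int_{\mathbb{R}}\int_{\mathbb{R}}\overline{\psi^\alpha_{a,b}(w)}\;\overline{\chi^\alpha_{a,b}(v)}\;\phi^\alpha_{a,b}(u)\,|a|^{2\rho-3}\,da\,db .$$ The Fourier transform is $\hat\phi(\omega)=\int_{\mathbb{R}}\phi(t)e^{-i\omega t}\,dt$. *)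

theory Defs
  imports "HOL-Analysis.Analysis" "HOL-Probability.Essential_Supremum"
begin

text \<open>Measurability and integration on the real line refer to the (complete) measure
  \<^const>\<open>lebesgue\<close>. Exponents \<open>p\<close> range over \<^typ>\<open>ennreal\<close>, so that
  \<open>p = \<infinity>\<close> is included; there \<open>1 / \<infinity> = 0\<close>.\<close>

definition in_Lp :: "ennreal \<Rightarrow> (real \<Rightarrow> complex) \<Rightarrow> bool" where
  "in_Lp p f \<longleftrightarrow> f \<in> borel_measurable lebesgue \<and>
     (if p = \<infinity> then esssup lebesgue (\<lambda>x. ennreal (norm (f x))) < \<infinity>
      else integrable lebesgue (\<lambda>x. norm (f x) powr enn2real p))"

text \<open>The real-valued norm; meaningful for \<open>1 \<le> p\<close> and functions satisfying
  \<^const>\<open>in_Lp\<close>.\<close>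

definition Lp_norm :: "ennreal \<Rightarrow> (real \<Rightarrow> complex) \<Rightarrow> real" where
  "Lp_norm p f =
     (if p = \<infinity> then enn2real (esssup lebesgue (\<lambda>x. ennreal (norm (f x))))
      else (LINT x|lebesgue. norm (f x) powr enn2real p) powr (1 / enn2real p))"

text \<open>The factor \<open>1 + \<bar>z\<bar>\<^sup>\<rho>\<close>. For \<open>\<rho> = 0\<close> the convention
  \<open>0 powr 0 = 0\<close> affects only the point \<open>z = 0\<close>.\<close>

definition weighted :: "real \<Rightarrow> (real \<Rightarrow> complex) \<Rightarrow> real \<Rightarrow> complex" where
  "weighted \<rho> f z = complex_of_real (1 + \<bar>z\<bar> powr \<rho>) * f z"

text \<open>A function in \<open>L\<^sup>2\<close> need not be integrable, so the integral
  \<open>\<integral> f(t) exp(-i\<omega>t) dt\<close> is read in the sense of Plancherel: as the limit in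
  \<open>L\<^sup>2\<close> of the integrals over \<open>[-n, n]\<close>. The limit is determined up to a null
  set, whence the choice; for \<open>f \<in> L\<^sup>1 \<inter> L\<^sup>2\<close> it agrees almost
  everywhere with the integral over the whole line.\<close>

definition truncated_fourier :: "nat \<Rightarrow> (real \<Rightarrow> complex) \<Rightarrow> real \<Rightarrow> complex" where
  "truncated_fourier n f \<omega> =
     (LINT t:{- real n..real n}|lebesgue. f t * exp (- \<i> * complex_of_real (\<omega> * t)))"

definition is_fourier_L2 :: "(real \<Rightarrow> complex) \<Rightarrow> (real \<Rightarrow> complex) \<Rightarrow> bool" where
  "is_fourier_L2 f F \<longleftrightarrow> F \<in> borel_measurable lebesgue \<and>
     (\<lambda>n. \<integral>\<^sup>+\<omega>. ennreal ((norm (F \<omega> - truncated_fourier n f \<omega>))\<^sup>2) \<partial>lebesgue)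
       \<longlonglongrightarrow> 0"

definition fourier_L2 :: "(real \<Rightarrow> complex) \<Rightarrow> real \<Rightarrow> complex" where
  "fourier_L2 f = (SOME F. is_fourier_L2 f F)"

text \<open>The constant \<open>C\<^sub>\<phi>\<close>, possibly infinite; it does not depend on the
  representative of the Fourier transform.\<close>

definition admissibility_const :: "(real \<Rightarrow> complex) \<Rightarrow> ennreal" where
  "admissibility_const \<phi> =
     (\<integral>\<^sup>+\<omega>. ennreal ((norm (fourier_L2 \<phi> \<omega>))\<^sup>2 / \<bar>\<omega>\<bar>) \<partial>lebesgue)"

text \<open>The family \<open>f\<^sup>\<alpha>\<^sub>a\<^sub>,\<^sub>b\<close>. The null set \<open>a = 0\<close>, where this
  is a junk value, is not removed from the integrals below.\<close>

definition daughter ::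
  "real \<Rightarrow> real \<Rightarrow> (real \<Rightarrow> complex) \<Rightarrow> real \<Rightarrow> real \<Rightarrow> real \<Rightarrow> complex" where
  "daughter \<alpha> \<rho> f a b t =
     exp (- (\<i> / 2) * complex_of_real ((t\<^sup>2 - b\<^sup>2) * cot (\<alpha> * pi / 2)))
       * complex_of_real (\<bar>a\<bar> powr (- \<rho>)) * f ((t - b) / a)"

text \<open>The function \<open>chi\<close> is spelled out because the Greek letter is the
  binder for vectors in \<^theory>\<open>HOL-Analysis.Finite_Cartesian_Product\<close>.\<close>

definition basic_integrand ::
  "real \<Rightarrow> real \<Rightarrow> (real \<Rightarrow> complex) \<Rightarrow> (real \<Rightarrow> complex) \<Rightarrow> (real \<Rightarrow> complex)
     \<Rightarrow> real \<Rightarrow> real \<Rightarrow> real \<Rightarrow> real \<Rightarrow> real \<Rightarrow> complex" where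
  "basic_integrand \<alpha> \<rho> \<phi> \<psi> chi u v w a b =
     cnj (daughter \<alpha> \<rho> \<psi> a b w) * cnj (daughter \<alpha> \<rho> chi a b v)
       * daughter \<alpha> \<rho> \<phi> a b u * complex_of_real (\<bar>a\<bar> powr (2 * \<rho> - 3))"

text \<open>Existence of the iterated Lebesgue integral defining the basic function; needed since
  the Bochner integral of a non-integrable function is \<open>0\<close> by convention.\<close>

definition basic_function_defined ::
  "real \<Rightarrow> real \<Rightarrow> (real \<Rightarrow> complex) \<Rightarrow> (real \<Rightarrow> complex) \<Rightarrow> (real \<Rightarrow> complex)
     \<Rightarrow> real \<Rightarrow> real \<Rightarrow> real \<Rightarrow> bool" where
  "basic_function_defined \<alpha> \<rho> \<phi> \<psi> chi u v w \<longleftrightarrow>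
     (AE b in lebesgue. integrable lebesgue (\<lambda>a. basic_integrand \<alpha> \<rho> \<phi> \<psi> chi u v w a b)) \<and>
     integrable lebesgue (\<lambda>b. LINT a|lebesgue. basic_integrand \<alpha> \<rho> \<phi> \<psi> chi u v w a b)"

definition basic_function ::
  "real \<Rightarrow> real \<Rightarrow> (real \<Rightarrow> complex) \<Rightarrow> (real \<Rightarrow> complex) \<Rightarrow> (real \<Rightarrow> complex)
     \<Rightarrow> real \<Rightarrow> real \<Rightarrow> real \<Rightarrow> complex" where
  "basic_function \<alpha> \<rho> \<phi> \<psi> chi u v w =
     complex_of_real (inverse (enn2real (admissibility_const \<phi>))) *
     (LINT b|lebesgue. LINT a|lebesgue. basic_integrand \<alpha> \<rho> \<phi> \<psi> chi u v w a b)"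

end

theory Submission
  imports Defs
begin

text \<open>The chirp factors have modulus one, so the modulus of the integrand is
  \<open>\<bar>a\<bar>\<close> to the power \<open>- \<rho> - 3\<close> times
  \<open>\<bar>\<psi>((w - b) / a) chi((v - b) / a) \<phi>((u - b) / a)\<bar>\<close>.
  Substituting \<open>b = w - a z\<close> and then \<open>s = 1 / a\<close> turns its double integral into that of
  \<open>\<bar>s\<bar>\<^sup>\<rho> \<bar>\<psi>(z) chi(z + (v - w) s) \<phi>(z + (u - w) s)\<bar>\<close>.
  With \<open>y = z + (u - w) s\<close> we have \<open>\<bar>u - w\<bar> \<bar>s\<bar> = \<bar>y - z\<bar> \<le> 2 max \<bar>y\<bar> \<bar>z\<bar>\<close>, which bounds
  \<open>\<bar>s\<bar>\<^sup>\<rho>\<close> by a constant times the product of the two weights at \<open>z\<close> and \<open>y\<close>;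
  Hoelder's inequality in \<open>s\<close> and integration in \<open>z\<close> conclude. Fubini's theorem needs joint
  measurability, so \<open>\<phi>\<close>, \<open>\<psi>\<close> and \<open>chi\<close> are first replaced by Borel functions; since
  \<open>a \<mapsto> c / a\<close> with \<open>c \<noteq> 0\<close> pulls null sets back to null sets, this alters the integrand,
  for almost every \<open>b\<close>, only on a null set of \<open>a\<close>. The argument gives the constant
  \<open>2\<^sup>\<rho>\<close> without the factor \<open>2\<close> to the power \<open>1 / p\<close>.\<close>

section \<open>Inversion as a change of variables for Lebesgue measure\<close>

text \<open>The map \<open>x \<mapsto> - 1 / x\<close> is used in place of \<open>1 / x\<close> because it is
  increasing on each half-line, as the substitution rule requires.\<close>
lemma lborel_eq_distr_neg_inverse:
  "lborel = distr (density lborel (\<lambda>x::real. ennreal (1 / x\<^sup>2))) borel (\<lambda>x. - 1 / x)"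
    (is "_ = ?N")
proof (rule measure_eqI)
  show "sets lborel = sets ?N" by simp
  fix A :: "real set" assume "A \<in> sets lborel"
  then have A[measurable]: "A \<in> sets borel" by simp
  have N: "emeasure ?N B = (\<integral>\<^sup>+x. ennreal (indicator B (- 1 / x) * (1 / x\<^sup>2)) \<partial>lborel)"
    if [measurable]: "B \<in> sets borel" for B
  proof -
    have "emeasure ?N B = (\<integral>\<^sup>+x. indicator B x \<partial>?N)"
      by simp
    also have "\<dots> = (\<integral>\<^sup>+x. ennreal (1 / x\<^sup>2) * indicator B (- 1 / x) \<partial>lborel)"
      by (subst nn_integral_distr) (simp_all add: nn_integral_density)
    also have "\<dots> = (\<integral>\<^sup>+x. ennreal (indicator B (- 1 / x) * (1 / x\<^sup>2)) \<partial>lborel)"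
      by (intro nn_integral_cong) (auto simp: indicator_def)
    finally show ?thesis .
  qed
  \<comment> \<open>The condition \<open>0 < a * b\<close> keeps 0 out of the interval from
    \<open>a\<close> to \<open>b\<close>, so x \<mapsto> -1/x is increasing there with continuous
    derivative 1/x^2 and the substitution rule applies.\<close>
  have piece: "emeasure lborel (A \<inter> {- 1 / a.. - 1 / b}) = emeasure ?N (A \<inter> {- 1 / a.. - 1 / b})"
    if ab: "a \<le> b" "0 < a * b" for a b :: real
  proof -
    have sg: "0 < a \<and> 0 < b \<or> a < 0 \<and> b < 0"
      using ab by (auto simp: zero_less_mult_iff)
    have mem: "- 1 / x \<in> {- 1 / a.. - 1 / b} \<longleftrightarrow> x \<in> {a..b}" if "x \<noteq> 0" for x
      using sg ab that by (cases "x > 0") (auto simp: field_simps mult_le_0_iff)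
    have "emeasure lborel (A \<inter> {- 1 / a.. - 1 / b})
      = (\<integral>\<^sup>+x. ennreal (indicator A x * indicator {- 1 / a.. - 1 / b} x) \<partial>lborel)"
      by (subst nn_integral_indicator[symmetric])
         (auto intro!: nn_integral_cong simp: indicator_def simp del: nn_integral_indicator)
    also have "\<dots> = (\<integral>\<^sup>+x. ennreal (indicator A (- 1 / x) * (1 / x\<^sup>2) * indicator {a..b} x) \<partial>lborel)"
    proof (rule nn_integral_substitution)
      show "set_borel_measurable borel {- 1 / a.. - 1 / b} (indicator A :: real \<Rightarrow> real)"
        unfolding set_borel_measurable_def by measurable
      show "((\<lambda>x. - 1 / x) has_real_derivative 1 / x\<^sup>2) (at x)" if "x \<in> {a..b}" for x
        using that sg by (auto intro!: derivative_eq_intros simp: power2_eq_square)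
      show "continuous_on {a..b} (\<lambda>x. 1 / x\<^sup>2)"
        using sg by (auto intro!: continuous_intros)
    qed (use ab in auto)
    also have "\<dots> = emeasure ?N (A \<inter> {- 1 / a.. - 1 / b})"
    proof (subst N)
      show "A \<inter> {- 1 / a.. - 1 / b} \<in> sets borel" by simp
      show "(\<integral>\<^sup>+x. ennreal (indicator A (- 1 / x) * (1 / x\<^sup>2) * indicator {a..b} x) \<partial>lborel)
        = (\<integral>\<^sup>+x. ennreal (indicator (A \<inter> {- 1 / a.. - 1 / b}) (- 1 / x) * (1 / x\<^sup>2)) \<partial>lborel)"
      proof (rule nn_integral_cong)
        fix x :: real
        show "ennreal (indicator A (- 1 / x) * (1 / x\<^sup>2) * indicator {a..b} x)
          = ennreal (indicator (A \<inter> {- 1 / a.. - 1 / b}) (- 1 / x) * (1 / x\<^sup>2))"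
          \<comment> \<open>At x = 0 both sides vanish because 1/0 = 0; elsewhere \<open>mem\<close>
            matches the two indicators.\<close>
          using mem[of x] by (cases "x = 0") (simp_all add: indicator_def)
      qed
    qed
    finally show ?thesis .
  qed
  \<comment> \<open>Two compact intervals that exhaust the negative and the positive half-line. The
    map x \<mapsto> -1/x exchanges them, so \<open>piece\<close> applies to each with the endpoints
    of the other.\<close>
  define S where "S n = {- real (Suc n).. - 1 / real (Suc n)} \<union> {1 / real (Suc n)..real (Suc n)}" for n
  have [measurable]: "S n \<in> sets borel" for n unfolding S_def by measurable
  have S_eq: "emeasure lborel (A \<inter> S n) = emeasure ?N (A \<inter> S n)" for n
  proof -
    let ?m = "real (Suc n)"
    let ?P = "{- ?m.. - 1 / ?m}" and ?Q = "{1 / ?m..?m}"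
    have neg: "- 1 / ?m < 0" and pos: "1 / ?m > 0" by auto
    have *: "A \<inter> S n = (A \<inter> ?P) \<union> (A \<inter> ?Q)" by (auto simp: S_def)
    have disj: "(A \<inter> ?P) \<inter> (A \<inter> ?Q) = {}"
    proof (rule equals0I)
      fix x assume "x \<in> (A \<inter> ?P) \<inter> (A \<inter> ?Q)"
      then have "x \<le> - 1 / ?m" "1 / ?m \<le> x" unfolding Int_iff atLeastAtMost_iff by blast+
      then show False using neg pos by linarith
    qed
    have m: "1 / ?m \<le> ?m" by (auto simp: field_simps)
    have P: "emeasure lborel (A \<inter> ?P) = emeasure ?N (A \<inter> ?P)"
      using piece[of "1 / ?m" ?m] m by (simp add: divide_simps)
    have Q: "emeasure lborel (A \<inter> ?Q) = emeasure ?N (A \<inter> ?Q)"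
    proof -
      have "- 1 / (- ?m) = 1 / ?m" "- 1 / (- 1 / ?m) = ?m" "- ?m \<le> - 1 / ?m" "0 < - ?m * (- 1 / ?m)"
        using m by (simp_all del: of_nat_Suc)
      then show ?thesis
        using piece[of "- ?m" "- 1 / ?m"] by (simp add: add.commute)
    qed
    have add: "emeasure M (A \<inter> S n) = emeasure M (A \<inter> ?P) + emeasure M (A \<inter> ?Q)"
      if "sets M = sets borel" for M
      unfolding * using disj that by (intro plus_emeasure[symmetric]) auto
    show ?thesis
      by (subst (1 2) add) (simp_all only: P Q sets_lborel sets_distr)
  qed
  have "incseq S"
  proof (rule incseq_SucI)
    fix n
    have "1 / real (Suc (Suc n)) \<le> 1 / real (Suc n)"
      by (intro divide_left_mono) auto
    moreover have "real (Suc n) \<le> real (Suc (Suc n))" by simp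
    ultimately show "S n \<subseteq> S (Suc n)"
      unfolding S_def by (intro Un_mono; simp only: atLeastatMost_subset_iff; intro disjI2 conjI; linarith)
  qed
  then have inc: "incseq (\<lambda>n. A \<inter> S n)" by (auto simp: incseq_def)
  have UN: "(\<Union>n. A \<inter> S n) = A - {0}"
  proof -
    have "\<exists>n. x \<in> S n" if x: "x \<noteq> 0" for x
    proof -
      obtain n where n: "max \<bar>x\<bar> (1 / \<bar>x\<bar>) < real n" using reals_Archimedean2 by blast
      then have "\<bar>x\<bar> \<le> real (Suc n)" "1 / \<bar>x\<bar> \<le> real (Suc n)" by auto
      then show ?thesis using x
        by (intro exI[of _ n]) (auto simp: S_def field_simps abs_if split: if_splits)
    qed
    moreover have "0 \<notin> S n" for n by (auto simp: S_def field_simps)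
    ultimately show ?thesis by auto
  qed
  \<comment> \<open>A measure without mass at 0 is determined by its values on the sets
    \<open>A \<inter> S n\<close>, by continuity from below.\<close>
  have Z: "emeasure M A = (SUP n. emeasure M (A \<inter> S n))"
    if M: "sets M = sets borel" "emeasure M {0::real} = 0" for M
  proof -
    have "emeasure M A = emeasure M (A - {0})"
      using M by (subst emeasure_Diff_null_set) (auto simp: null_sets_def)
    also have "\<dots> = (SUP n. emeasure M (A \<inter> S n))"
      unfolding UN[symmetric] using inc by (intro SUP_emeasure_incseq[symmetric]) (auto simp: M)
    finally show ?thesis .
  qed
  \<comment> \<open>By the convention 1/0 = 0 the only preimage of 0 is 0 itself, where the density
    also takes the value 0.\<close>
  have N0: "emeasure ?N {0} = 0"
    by (subst N) (auto simp: nn_integral_0_iff_AE indicator_def)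
  have "emeasure lborel A = (SUP n. emeasure lborel (A \<inter> S n))"
    by (rule Z) simp_all
  also have "\<dots> = (SUP n. emeasure ?N (A \<inter> S n))"
    by (simp only: S_eq)
  also have "\<dots> = emeasure ?N A"
    by (rule Z[symmetric, OF sets_distr N0])
  finally show "emeasure lborel A = emeasure ?N A" .
qed

text \<open>Lebesgue measure is invariant under reflection, which removes the sign from x \<mapsto>
  -1/x.\<close>

lemma nn_integral_inverse:
  fixes f :: "real \<Rightarrow> ennreal"
  assumes [measurable]: "f \<in> borel_measurable borel"
  shows "(\<integral>\<^sup>+x. f x \<partial>lborel) = (\<integral>\<^sup>+x. ennreal (1 / x\<^sup>2) * f (1 / x) \<partial>lborel)"
proof -
  have "(\<integral>\<^sup>+x. f x \<partial>lborel) = (\<integral>\<^sup>+x. f (- x) \<partial>lborel)"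
    using nn_integral_real_affine[of f "-1" 0] by simp
  also have "\<dots> = (\<integral>\<^sup>+x. ennreal (1 / x\<^sup>2) * f (1 / x) \<partial>lborel)"
    by (subst lborel_eq_distr_neg_inverse)
       (simp add: nn_integral_distr nn_integral_density)
  finally show ?thesis .
qed

text \<open>The exceptional set lies in a Borel null set \<open>N\<close>. Inversion turns the
  integral of the indicator of \<open>N\<close> at c/x, weighted by 1/x^2, into the measure of a
  dilate of \<open>N\<close>, which is zero; the weight is positive off 0, so the indicator vanishes
  almost everywhere.\<close>

lemma AE_lborel_inverse:
  assumes "AE x in lborel. P x" and c: "c \<noteq> 0"
  shows "AE x::real in lborel. P (c / x)"
proof -
  obtain N where N: "{x. \<not> P x} \<subseteq> N" and N0: "N \<in> null_sets lborel"
    using assms(1) unfolding eventually_ae_filter by auto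
  have [measurable]: "N \<in> sets borel" using N0 by auto
  have "(\<integral>\<^sup>+x. ennreal (1 / x\<^sup>2) * indicator N (c * (1 / x)) \<partial>lborel)
      = (\<integral>\<^sup>+x. indicator N (c * x) \<partial>lborel)"
    by (subst (2) nn_integral_inverse) simp_all
  also have "\<dots> = 0"
    using nn_integral_real_affine[of "indicator N" c 0] N0 c by (auto simp: null_sets_def)
  finally have "AE x in lborel. ennreal (1 / x\<^sup>2) * indicator N (c * (1 / x)) = 0"
    by (subst (asm) nn_integral_0_iff_AE) auto
  moreover have "AE x in lborel. x \<noteq> (0::real)"
    by (rule AE_lborel_singleton)
  ultimately show ?thesis
    by eventually_elim (use N in \<open>auto simp: indicator_def split: if_splits\<close>)
qed

section \<open>Conjugate exponents and Hoelder's inequality\<close>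

text \<open>Separates the endpoints, where Hoelder rests on an essential bound, from the real
  exponents above 1, where Young's inequality is available.\<close>

lemma conjugate_exponents_cases:
  fixes p q :: ennreal
  assumes "1 \<le> p" "1 \<le> q" "1 / p + 1 / q = 1"
  obtains (left_top) "p = \<infinity>" "q = 1"
    | (right_top) "p = 1" "q = \<infinity>"
    | (finite) r s where "p = ennreal r" "q = ennreal s" "1 < r" "1 < s" "1 / r + 1 / s = 1"
proof (cases p)
  case p: (real r)
  show ?thesis
  proof (cases q)
    case q: (real s)
    have rs: "1 \<le> r" "1 \<le> s"
      using assms p q by (simp_all add: ennreal_le_iff2 flip: ennreal_1)
    have "ennreal (1 / r + 1 / s) = 1"
      using assms(3) rs p q by (simp add: divide_ennreal flip: ennreal_1 ennreal_plus)
    then have "1 / r + 1 / s = 1"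
      using rs by (subst (asm) ennreal_eq_1)
    moreover have "0 < 1 / r" "0 < 1 / s" using rs by auto
    ultimately have "1 / r < 1" "1 / s < 1" by linarith+
    then have "1 < r" "1 < s" using rs by (simp_all add: field_simps)
    moreover note \<open>1 / r + 1 / s = 1\<close>
    ultimately show ?thesis using finite p q by blast
  next
    case top
    then have "1 / p = 1" using assms by simp
    then have "p = 1" using p assms
      by (simp add: divide_ennreal flip: ennreal_1)
    then show ?thesis using top right_top by simp
  qed
next
  case top
  then have "1 / q = 1" using assms by simp
  then have "q = 1"
    using assms(2) by (cases q) (simp_all add: divide_ennreal flip: ennreal_1)
  then show ?thesis using top left_top by simp
qed

lemma in_Lp_borel_measurable: "in_Lp p f \<Longrightarrow> f \<in> borel_measurable lebesgue"
  by (simp add: in_Lp_def)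

lemma Lp_norm_nonneg: "0 \<le> Lp_norm p f"
  by (simp add: Lp_norm_def)

lemma AE_norm_le_Lp_norm_top:
  assumes "in_Lp \<infinity> f"
  shows "AE x in lebesgue. norm (f x) \<le> Lp_norm \<infinity> f"
proof -
  let ?e = "esssup lebesgue (\<lambda>x. ennreal (norm (f x)))"
  have fin: "?e < \<infinity>" using assms by (simp add: in_Lp_def)
  have "AE x in lebesgue. ennreal (norm (f x)) \<le> ?e" by (rule esssup_AE)
  then show ?thesis
  proof eventually_elim
    case (elim x)
    \<comment> \<open>Since \<open>enn2real\<close> sends \<infinity> to 0, monotonicity here relies
      on the essential supremum being finite.\<close>
    then have "enn2real (ennreal (norm (f x))) \<le> enn2real ?e"
      using fin by (intro enn2real_mono) auto
    then show ?case by (simp add: Lp_norm_def)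
  qed
qed

lemma nn_integral_norm_in_L1:
  assumes "in_Lp 1 f"
  shows "(\<integral>\<^sup>+x. ennreal (norm (f x)) \<partial>lebesgue) = ennreal (Lp_norm 1 f)"
  using assms by (simp add: in_Lp_def Lp_norm_def nn_integral_eq_integral)

lemma nn_integral_Holder_top:
  assumes "in_Lp \<infinity> f" "in_Lp 1 g"
  shows "(\<integral>\<^sup>+x. ennreal (norm (f x) * norm (g x)) \<partial>lebesgue)
    \<le> ennreal (Lp_norm \<infinity> f * Lp_norm 1 g)"
proof -
  note [measurable] = assms[THEN in_Lp_borel_measurable]
  have "(\<integral>\<^sup>+x. ennreal (norm (f x) * norm (g x)) \<partial>lebesgue)
    \<le> (\<integral>\<^sup>+x. ennreal (Lp_norm \<infinity> f) * ennreal (norm (g x)) \<partial>lebesgue)"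
    using AE_norm_le_Lp_norm_top[OF assms(1)]
    by (intro nn_integral_mono_AE, eventually_elim)
       (auto simp: ennreal_mult'[symmetric] Lp_norm_nonneg intro!: ennreal_leI mult_right_mono)
  also have "\<dots> = ennreal (Lp_norm \<infinity> f * Lp_norm 1 g)"
    by (simp add: nn_integral_cmult nn_integral_norm_in_L1[OF assms(2)] ennreal_mult' Lp_norm_nonneg)
  finally show ?thesis .
qed

text \<open>Young's inequality is applied to the functions divided by their norms \<open>A\<close>
  and \<open>B\<close>; integrating gives \<open>A * B\<close> times 1/r + 1/s = 1.\<close>

lemma nn_integral_Holder_finite:
  fixes f g :: "real \<Rightarrow> complex"
  assumes rs: "1 < r" "1 < s" "1 / r + 1 / s = 1"
    and f: "in_Lp (ennreal r) f" and g: "in_Lp (ennreal s) g"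
  shows "(\<integral>\<^sup>+x. ennreal (norm (f x) * norm (g x)) \<partial>lebesgue)
    \<le> ennreal (Lp_norm (ennreal r) f * Lp_norm (ennreal s) g)"
proof -
  note [measurable] = f[THEN in_Lp_borel_measurable] g[THEN in_Lp_borel_measurable]
  define I where "I = (LINT x|lebesgue. norm (f x) powr r)"
  define J where "J = (LINT x|lebesgue. norm (g x) powr s)"
  define A where "A = I powr (1 / r)"
  define B where "B = J powr (1 / s)"
  have If: "integrable lebesgue (\<lambda>x. norm (f x) powr r)"
    and Ig: "integrable lebesgue (\<lambda>x. norm (g x) powr s)"
    using f g rs by (simp_all add: in_Lp_def)
  have A: "Lp_norm (ennreal r) f = A" and B: "Lp_norm (ennreal s) g = B"
    using rs by (simp_all add: Lp_norm_def A_def B_def I_def J_def)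
  have IJ: "0 \<le> I" "0 \<le> J" by (simp_all add: I_def J_def)
  have zero: "AE x in lebesgue. h x = 0"
    if "integrable lebesgue (\<lambda>x. norm (h x) powr t)" "(LINT x|lebesgue. norm (h x) powr t) = 0"
    for h :: "real \<Rightarrow> complex" and t
    using that by (subst (asm) integral_nonneg_eq_0_iff_AE) auto
  show ?thesis
  proof (cases "I = 0 \<or> J = 0")
    \<comment> \<open>Normalisation is impossible when a norm is zero, but then the product vanishes
      almost everywhere.\<close>
    case True
    then have "AE x in lebesgue. f x = 0 \<or> g x = 0"
      using zero[OF If] zero[OF Ig] unfolding I_def J_def by auto
    then have "AE x in lebesgue. ennreal (norm (f x) * norm (g x)) = 0"
      by eventually_elim auto
    then have "(\<integral>\<^sup>+x. ennreal (norm (f x) * norm (g x)) \<partial>lebesgue) = 0"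
      by (subst nn_integral_0_iff_AE) auto
    then show ?thesis by simp
  next
    case False
    then have pos: "0 < A" "0 < B" and Ar: "A powr r = I" and Bs: "B powr s = J"
      using IJ rs by (auto simp: A_def B_def powr_powr)
    have young: "norm (f x) * norm (g x)
        \<le> A * B * (norm (f x) powr r / (r * I) + norm (g x) powr s / (s * J))" for x
    proof -
      have "(norm (f x) / A) * (norm (g x) / B)
          \<le> (norm (f x) / A) powr r / r + (norm (g x) / B) powr s / s"
        using rs pos by (intro Youngs_inequality) auto
      also have "\<dots> = norm (f x) powr r / (r * I) + norm (g x) powr s / (s * J)"
        using pos by (simp add: powr_divide Ar Bs mult.commute)
      finally show ?thesis using pos by (simp add: field_simps)
    qed
    have int: "integrable lebesgue
        (\<lambda>x. A * B * (norm (f x) powr r / (r * I) + norm (g x) powr s / (s * J)))"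
      using If Ig by (intro integrable_mult_right Bochner_Integration.integrable_add integrable_divide) auto
    have "(\<integral>\<^sup>+x. ennreal (norm (f x) * norm (g x)) \<partial>lebesgue)
      \<le> (\<integral>\<^sup>+x. ennreal (A * B * (norm (f x) powr r / (r * I) + norm (g x) powr s / (s * J))) \<partial>lebesgue)"
      using young by (intro nn_integral_mono ennreal_leI)
    also have "\<dots> = ennreal (LINT x|lebesgue. A * B * (norm (f x) powr r / (r * I) + norm (g x) powr s / (s * J)))"
      using int IJ rs pos by (intro nn_integral_eq_integral) (auto intro!: AE_I2)
    also have "(LINT x|lebesgue. A * B * (norm (f x) powr r / (r * I) + norm (g x) powr s / (s * J)))
      = A * B * (I / (r * I) + J / (s * J))"
      using If Ig by (simp add: I_def[symmetric] J_def[symmetric])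
    also have "\<dots> = A * B"
      using False rs by simp
    finally show ?thesis by (simp add: A B)
  qed
qed

lemma nn_integral_Holder:
  assumes "1 \<le> p" "1 \<le> q" "1 / p + 1 / q = 1" and f: "in_Lp p f" and g: "in_Lp q g"
  shows "(\<integral>\<^sup>+x. ennreal (norm (f x) * norm (g x)) \<partial>lebesgue) \<le> ennreal (Lp_norm p f * Lp_norm q g)"
  using assms(1-3)
proof (cases rule: conjugate_exponents_cases)
  case left_top
  then show ?thesis using nn_integral_Holder_top f g by simp
next
  case right_top
  then show ?thesis using nn_integral_Holder_top[of g f] f g by (simp add: mult.commute)
next
  case (finite r s)
  then show ?thesis using nn_integral_Holder_finite f g by simp
qed

section \<open>L^p norms under affine maps and under change of representative\<close>

text \<open>For finite \<open>p\<close> the substitution divides the integral by |c|, and the root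
  of order \<open>p\<close> gives the factor. For \<open>p = \<infinity>\<close> affine maps
  preserve null sets and the factor is |c|^0 = 1; only an upper bound is derived there. Borel
  measurability lets the integrals pass between \<open>lebesgue\<close> and
  \<open>lborel\<close>.\<close>

lemma
  fixes f :: "real \<Rightarrow> complex"
  assumes p: "1 \<le> p" and c: "c \<noteq> 0"
    and f: "in_Lp p f" and [measurable]: "f \<in> borel_measurable borel"
  shows in_Lp_affine: "in_Lp p (\<lambda>x. f (t + c * x))"
    and Lp_norm_affine:
      "Lp_norm p (\<lambda>x. f (t + c * x)) \<le> \<bar>c\<bar> powr (- enn2real (1 / p)) * Lp_norm p f"
proof -
  let ?g = "\<lambda>x. f (t + c * x)"
  have [measurable]: "f \<in> borel_measurable lborel" "?g \<in> borel_measurable lborel" by simp_all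
  have gm: "?g \<in> borel_measurable lebesgue" by (intro measurable_completion) simp
  have "in_Lp p ?g \<and> Lp_norm p ?g \<le> \<bar>c\<bar> powr (- enn2real (1 / p)) * Lp_norm p f"
  proof (cases p)
    case (real r)
    then have r: "1 \<le> r" using p by (simp flip: ennreal_1)
    have m: "(\<lambda>x. norm (f x) powr r) \<in> borel_measurable lborel"
      "(\<lambda>x. norm (?g x) powr r) \<in> borel_measurable lborel" by measurable
    have int: "integrable lborel (\<lambda>x. norm (f x) powr r)"
      using f real r integrable_completion[OF m(1)] by (simp add: in_Lp_def)
    have int': "integrable lborel (\<lambda>x. norm (?g x) powr r)"
      using int c by (rule lborel_integrable_real_affine)
    then have 1: "in_Lp p ?g"
      using gm real r integrable_completion[OF m(2)] by (simp add: in_Lp_def)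
    have "(LINT x|lborel. norm (f x) powr r) = \<bar>c\<bar> * (LINT x|lborel. norm (?g x) powr r)"
      using lborel_integral_real_affine[OF c, of "\<lambda>x. norm (f x) powr r" t] by simp
    then have "(LINT x|lborel. norm (?g x) powr r) = \<bar>c\<bar> powr (-1) * (LINT x|lborel. norm (f x) powr r)"
      using c by (simp add: powr_minus field_simps)
    then have "(LINT x|lborel. norm (?g x) powr r) powr (1 / r)
        = \<bar>c\<bar> powr (- (1 / r)) * (LINT x|lborel. norm (f x) powr r) powr (1 / r)"
      by (simp only: powr_mult powr_powr) simp
    moreover have "enn2real (1 / p) = 1 / r"
      using real r by (simp add: divide_ennreal flip: ennreal_1)
    ultimately show ?thesis
      using 1 real r m by (simp add: Lp_norm_def integral_completion)
  next
    case top
    have f': "in_Lp \<infinity> f" using f top by simp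
    have "AE x in lborel. norm (f x) \<le> Lp_norm \<infinity> f"
      using AE_norm_le_Lp_norm_top[OF f'] by (simp add: AE_completion_iff)
    then have "AE x in lborel. norm (?g x) \<le> Lp_norm \<infinity> f"
      by (intro AE_borel_affine[OF c, where P="\<lambda>x. norm (f x) \<le> Lp_norm \<infinity> f"]) simp_all
    then have "AE x in lebesgue. ennreal (norm (?g x)) \<le> ennreal (Lp_norm \<infinity> f)"
      by (intro AE_completion) (auto elim!: eventually_mono intro: ennreal_leI)
    then have *: "esssup lebesgue (\<lambda>x. ennreal (norm (?g x))) \<le> ennreal (Lp_norm \<infinity> f)"
      using gm by (intro esssup_I) auto
    then have "in_Lp \<infinity> ?g"
      using gm by (auto simp: in_Lp_def intro: le_less_trans)
    moreover have "Lp_norm \<infinity> ?g \<le> Lp_norm \<infinity> f"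
      using * by (subst Lp_norm_def) (simp add: enn2real_leI Lp_norm_nonneg)
    ultimately show ?thesis using top c by simp
  qed
  then show "in_Lp p ?g" "Lp_norm p ?g \<le> \<bar>c\<bar> powr (- enn2real (1 / p)) * Lp_norm p f"
    by auto
qed

lemma lebesgue_ex_borel_complex:
  fixes f :: "real \<Rightarrow> complex"
  assumes f: "f \<in> borel_measurable lebesgue"
  obtains g where "g \<in> borel_measurable borel" "AE x in lborel. f x = g x"
proof -
  have "(\<lambda>x. Re (f x)) \<in> borel_measurable lebesgue" "(\<lambda>x. Im (f x)) \<in> borel_measurable lebesgue"
    using f by measurable
  then obtain h k where hk: "h \<in> borel_measurable lborel" "AE x in lborel. Re (f x) = h x"
    "k \<in> borel_measurable lborel" "AE x in lborel. Im (f x) = k x"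
    by (blast dest: completion_ex_borel_measurable_real)
  have [measurable]: "h \<in> borel_measurable borel" "k \<in> borel_measurable borel"
    using hk by simp_all
  have "AE x in lborel. f x = Complex (h x) (k x)"
    using hk(2,4) by eventually_elim (simp add: complex_eq_iff)
  moreover have "(\<lambda>x. Complex (h x) (k x)) \<in> borel_measurable borel"
    unfolding Complex_eq by measurable
  ultimately show ?thesis using that by blast
qed

text \<open>Transfers the hypotheses and norms to Borel representatives. Measurability of
  \<open>g\<close> comes from completeness of the measure.\<close>

lemma
  assumes f: "in_Lp p f" and eq: "AE x in lborel. f x = g x"
  shows in_Lp_cong_AE: "in_Lp p g"
    and Lp_norm_cong_AE: "Lp_norm p g = Lp_norm p f"
proof -
  have ae: "AE x in lebesgue. f x = g x" using eq by (rule AE_completion)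
  have fm [measurable]: "f \<in> borel_measurable lebesgue" using f by (rule in_Lp_borel_measurable)
  have gm [measurable]: "g \<in> borel_measurable lebesgue"
    using fm ae by (rule borel_measurable_AE)
  have sup: "esssup lebesgue (\<lambda>x. ennreal (norm (g x))) = esssup lebesgue (\<lambda>x. ennreal (norm (f x)))"
    using ae by (intro esssup_AE_cong) (auto elim!: eventually_mono)
  have int: "integrable lebesgue (\<lambda>x. norm (g x) powr r) \<longleftrightarrow> integrable lebesgue (\<lambda>x. norm (f x) powr r)"
    and eq: "(LINT x|lebesgue. norm (g x) powr r) = (LINT x|lebesgue. norm (f x) powr r)" for r
    using ae by (intro integrable_cong_AE integral_cong_AE; auto elim!: eventually_mono)+
  show "in_Lp p g" "Lp_norm p g = Lp_norm p f"
    using f gm unfolding in_Lp_def Lp_norm_def sup int eq by auto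
qed

section \<open>Modulus and measurability of the integrand, and the weight inequality\<close>

lemma norm_basic_integrand:
  "norm (basic_integrand \<alpha> \<rho> \<phi> \<psi> chi u v w a b)
    = \<bar>a\<bar> powr (- \<rho> - 3) * (norm (\<psi> ((w - b) / a)) * (norm (chi ((v - b) / a)) * norm (\<phi> ((u - b) / a))))"
proof -
  have d: "norm (daughter \<alpha> \<rho> f a b t) = \<bar>a\<bar> powr (- \<rho>) * norm (f ((t - b) / a))" for f t
    by (simp add: daughter_def norm_mult)
  \<comment> \<open>Each of the three daughters contributes the exponent -\<rho>, and the measure
    contributes 2\<rho> - 3.\<close>
  have "\<bar>a\<bar> powr (- \<rho> - 3) = \<bar>a\<bar> powr (- \<rho>) * \<bar>a\<bar> powr (- \<rho>) * \<bar>a\<bar> powr (- \<rho>) * \<bar>a\<bar> powr (2 * \<rho> - 3)"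
    by (simp only: powr_add[symmetric]) simp
  then show ?thesis
    by (simp add: basic_integrand_def norm_mult d)
qed

lemma basic_integrand_borel_measurable:
  assumes [measurable]: "\<phi> \<in> borel_measurable borel" "\<psi> \<in> borel_measurable borel"
    "chi \<in> borel_measurable borel"
  shows "(\<lambda>(b, a). basic_integrand \<alpha> \<rho> \<phi> \<psi> chi u v w a b) \<in> borel_measurable (borel \<Otimes>\<^sub>M borel)"
proof -
  have [measurable]: "(\<lambda>x. daughter \<alpha> \<rho> f (snd x) (fst x) t) \<in> borel_measurable (borel \<Otimes>\<^sub>M borel)"
    if [measurable]: "f \<in> borel_measurable borel" for f t
    unfolding daughter_def by measurable
  have [measurable]: "cnj \<in> borel_measurable borel"
    by (intro borel_measurable_continuous_onI continuous_intros)
  show ?thesis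
    unfolding basic_integrand_def case_prod_beta by measurable
qed

lemma weight_bound:
  assumes "0 \<le> \<rho>" and d: "d \<noteq> (0::real)"
  shows "\<bar>s\<bar> powr \<rho> \<le> 2 powr \<rho> * \<bar>d\<bar> powr (- \<rho>) * ((1 + \<bar>z\<bar> powr \<rho>) * (1 + \<bar>z + d * s\<bar> powr \<rho>))"
proof -
  let ?y = "z + d * s"
  have "\<bar>d\<bar> * \<bar>s\<bar> = \<bar>?y - z\<bar>" by (simp add: abs_mult)
  also have "\<dots> \<le> \<bar>?y\<bar> + \<bar>z\<bar>" by (rule abs_triangle_ineq4)
  also have "\<dots> \<le> 2 * max \<bar>z\<bar> \<bar>?y\<bar>" by (simp add: max_def)
  finally have "\<bar>d\<bar> * \<bar>s\<bar> \<le> 2 * max \<bar>z\<bar> \<bar>?y\<bar>" .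
  then have "(\<bar>d\<bar> * \<bar>s\<bar>) powr \<rho> \<le> (2 * max \<bar>z\<bar> \<bar>?y\<bar>) powr \<rho>"
    using assms by (intro powr_mono2) auto
  also have "\<dots> = 2 powr \<rho> * max \<bar>z\<bar> \<bar>?y\<bar> powr \<rho>"
    by (simp add: powr_mult)
  \<comment> \<open>The power of the maximum is one of the two powers, and each is below the product
    because both weights are at least 1.\<close>
  also have "\<dots> \<le> 2 powr \<rho> * ((1 + \<bar>z\<bar> powr \<rho>) * (1 + \<bar>?y\<bar> powr \<rho>))"
    by (intro mult_left_mono) (auto simp: max_def algebra_simps)
  finally have le: "(\<bar>d\<bar> * \<bar>s\<bar>) powr \<rho> \<le> 2 powr \<rho> * ((1 + \<bar>z\<bar> powr \<rho>) * (1 + \<bar>?y\<bar> powr \<rho>))" .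
  have "\<bar>s\<bar> powr \<rho> = \<bar>d\<bar> powr (- \<rho>) * (\<bar>d\<bar> * \<bar>s\<bar>) powr \<rho>"
    using d by (simp add: powr_mult powr_minus)
  also have "\<dots> \<le> \<bar>d\<bar> powr (- \<rho>) * (2 powr \<rho> * ((1 + \<bar>z\<bar> powr \<rho>) * (1 + \<bar>?y\<bar> powr \<rho>)))"
    using le by (rule mult_left_mono) simp
  finally show ?thesis by (simp only: mult_ac)
qed

lemma norm_weighted: "norm (weighted \<rho> f z) = (1 + \<bar>z\<bar> powr \<rho>) * norm (f z)"
  by (simp add: weighted_def norm_mult del: of_real_add)

lemma weighted_borel_measurable [measurable]:
  assumes [measurable]: "f \<in> borel_measurable borel"
  shows "weighted \<rho> f \<in> borel_measurable borel"
  unfolding weighted_def by measurable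

section \<open>The absolute double integral for Borel functions\<close>

lemma nn_integral_basic_integrand_le:
  fixes \<phi> \<psi> chi :: "real \<Rightarrow> complex"
  assumes \<rho>: "0 \<le> \<rho>" and pq: "1 \<le> p" "1 \<le> q" "1 / p + 1 / q = 1"
    and [measurable]: "\<phi> \<in> borel_measurable borel" "\<psi> \<in> borel_measurable borel"
      "chi \<in> borel_measurable borel"
    and \<phi>: "in_Lp p (weighted \<rho> \<phi>)" and chi: "in_Lp q chi" and \<psi>: "in_Lp 1 (weighted \<rho> \<psi>)"
    and c: "v \<noteq> w" and d: "u \<noteq> w"
  shows "(\<integral>\<^sup>+b. \<integral>\<^sup>+a. ennreal (norm (basic_integrand \<alpha> \<rho> \<phi> \<psi> chi u v w a b)) \<partial>lborel \<partial>lborel)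
    \<le> ennreal (2 powr \<rho> * \<bar>v - w\<bar> powr (- enn2real (1 / q)) * \<bar>u - w\<bar> powr (- enn2real (1 / p) - \<rho>)
        * Lp_norm q chi * Lp_norm p (weighted \<rho> \<phi>) * Lp_norm 1 (weighted \<rho> \<psi>))"
proof -
  define G where "G z s = ennreal (\<bar>s\<bar> powr \<rho>
      * (norm (\<psi> z) * (norm (chi (z + (v - w) * s)) * norm (\<phi> (z + (u - w) * s)))))" for z s
  define C where "C = \<bar>v - w\<bar> powr (- enn2real (1 / q)) * Lp_norm q chi
      * (\<bar>u - w\<bar> powr (- enn2real (1 / p)) * Lp_norm p (weighted \<rho> \<phi>))"
  have C0: "0 \<le> C" by (simp add: C_def Lp_norm_nonneg)
  \<comment> \<open>For fixed \<open>a\<close>, the substitution b = w - a z has Jacobian |a|. The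
    remaining power of |a| splits into |1/a|^\<rho> and the weight 1/a^2 that the inversion s = 1/a
    will absorb.\<close>
  have slice: "(\<integral>\<^sup>+b. ennreal (norm (basic_integrand \<alpha> \<rho> \<phi> \<psi> chi u v w a b)) \<partial>lborel)
      = (\<integral>\<^sup>+z. ennreal (1 / a\<^sup>2) * G z (1 / a) \<partial>lborel)" for a
  proof (cases "a = 0")
    \<comment> \<open>Both sides are 0 by the conventions \<open>0 powr x = 0\<close> and 1/0 =
      0.\<close>
    case True
    then show ?thesis by (simp add: norm_basic_integrand)
  next
    case False
    have "(\<integral>\<^sup>+b. ennreal (norm (basic_integrand \<alpha> \<rho> \<phi> \<psi> chi u v w a b)) \<partial>lborel)
      = ennreal \<bar>a\<bar> * (\<integral>\<^sup>+z. ennreal (norm (basic_integrand \<alpha> \<rho> \<phi> \<psi> chi u v w a (w + (- a) * z))) \<partial>lborel)"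
      unfolding norm_basic_integrand using False
      by (subst nn_integral_real_affine[where c="- a" and t=w]) simp_all
    also have "\<dots> = (\<integral>\<^sup>+z. ennreal \<bar>a\<bar> * ennreal (norm (basic_integrand \<alpha> \<rho> \<phi> \<psi> chi u v w a (w + (- a) * z))) \<partial>lborel)"
      unfolding norm_basic_integrand by (intro nn_integral_cmult[symmetric]) measurable
    also have "\<dots> = (\<integral>\<^sup>+z. ennreal (1 / a\<^sup>2) * G z (1 / a) \<partial>lborel)"
    proof (rule nn_integral_cong)
      fix z
      have "(w - (w + (- a) * z)) / a = z" "(v - (w + (- a) * z)) / a = z + (v - w) * (1 / a)"
        "(u - (w + (- a) * z)) / a = z + (u - w) * (1 / a)"
        using False by (simp_all add: field_simps)
      moreover have "\<bar>a\<bar> * \<bar>a\<bar> powr (- \<rho> - 3) = 1 / a\<^sup>2 * \<bar>1 / a\<bar> powr \<rho>"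
      proof -
        have "\<bar>a\<bar> powr 1 * \<bar>a\<bar> powr (- \<rho> - 3) = \<bar>a\<bar> powr (- 2) * \<bar>a\<bar> powr (- \<rho>)"
          by (simp only: powr_add[symmetric]) simp
        moreover have "\<bar>a\<bar> powr 1 = \<bar>a\<bar>" "\<bar>a\<bar> powr (- 2) = 1 / a\<^sup>2"
          "\<bar>a\<bar> powr (- \<rho>) = \<bar>1 / a\<bar> powr \<rho>"
          using False by (simp_all add: powr_minus powr_divide field_simps)
        ultimately show ?thesis by simp
      qed
      ultimately show "ennreal \<bar>a\<bar> * ennreal (norm (basic_integrand \<alpha> \<rho> \<phi> \<psi> chi u v w a (w + (- a) * z)))
          = ennreal (1 / a\<^sup>2) * G z (1 / a)"
        unfolding norm_basic_integrand G_def
        by (simp only: ennreal_mult'[symmetric] abs_ge_zero zero_le_divide_1_iff zero_le_power2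
            mult.assoc[symmetric])
    qed
    finally show ?thesis .
  qed
  have Gm [measurable]: "(\<lambda>(z, s). G z s) \<in> borel_measurable (borel \<Otimes>\<^sub>M borel)"
    unfolding G_def by measurable
  \<comment> \<open>The bound is uniform in \<open>z\<close>: translations leave the norms alone,
    and the slopes v - w and u - w give the two scaling factors in \<open>C\<close>.\<close>
  have holder: "(\<integral>\<^sup>+s. ennreal (norm (chi (z + (v - w) * s)) * norm (weighted \<rho> \<phi> (z + (u - w) * s))) \<partial>lborel)
      \<le> ennreal C" for z
  proof -
    have v: "v - w \<noteq> 0" and u: "u - w \<noteq> 0" using c d by auto
    have qp: "1 / q + 1 / p = 1" using pq by (simp add: add.commute)
    have "(\<integral>\<^sup>+s. ennreal (norm (chi (z + (v - w) * s)) * norm (weighted \<rho> \<phi> (z + (u - w) * s))) \<partial>lborel)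
        \<le> ennreal (Lp_norm q (\<lambda>s. chi (z + (v - w) * s)) * Lp_norm p (\<lambda>s. weighted \<rho> \<phi> (z + (u - w) * s)))"
      using nn_integral_Holder[OF pq(2,1) qp in_Lp_affine[OF pq(2) v chi] in_Lp_affine[OF pq(1) u \<phi>]]
      by (simp add: nn_integral_completion)
    also have "\<dots> \<le> ennreal C"
      unfolding C_def using c d pq \<phi> chi
      by (intro ennreal_leI mult_mono Lp_norm_affine) (auto simp: Lp_norm_nonneg)
    finally show ?thesis .
  qed
  define K where "K = 2 powr \<rho> * \<bar>u - w\<bar> powr (- \<rho>)"
  have K0: "0 \<le> K" by (simp add: K_def)
  \<comment> \<open>Of the two weights from \<open>weight_bound\<close>, the one at \<open>z\<close>
    is constant in \<open>s\<close> and joins \<psi>, while the other joins \<phi> under Hoelder's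
    inequality. \<open>K\<close> is the remaining constant.\<close>
  have inner: "(\<integral>\<^sup>+s. G z s \<partial>lborel) \<le> ennreal (K * C) * ennreal (norm (weighted \<rho> \<psi> z))" for z
  proof -
    have "(\<integral>\<^sup>+s. G z s \<partial>lborel) \<le> (\<integral>\<^sup>+s. ennreal (K * norm (weighted \<rho> \<psi> z))
        * ennreal (norm (chi (z + (v - w) * s)) * norm (weighted \<rho> \<phi> (z + (u - w) * s))) \<partial>lborel)"
    proof (rule nn_integral_mono)
      fix s
      let ?n = "norm (\<psi> z) * (norm (chi (z + (v - w) * s)) * norm (\<phi> (z + (u - w) * s)))"
      have "\<bar>s\<bar> powr \<rho> * ?n
          \<le> K * ((1 + \<bar>z\<bar> powr \<rho>) * (1 + \<bar>z + (u - w) * s\<bar> powr \<rho>)) * ?n"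
        unfolding K_def using \<rho> d by (intro mult_right_mono weight_bound) auto
      also have "\<dots> = K * norm (weighted \<rho> \<psi> z)
          * (norm (chi (z + (v - w) * s)) * norm (weighted \<rho> \<phi> (z + (u - w) * s)))"
        by (simp only: norm_weighted mult_ac)
      finally show "G z s \<le> ennreal (K * norm (weighted \<rho> \<psi> z))
          * ennreal (norm (chi (z + (v - w) * s)) * norm (weighted \<rho> \<phi> (z + (u - w) * s)))"
        using K0 by (simp add: G_def ennreal_mult'[symmetric] ennreal_leI)
    qed
    also have "\<dots> \<le> ennreal (K * norm (weighted \<rho> \<psi> z)) * ennreal C"
      by (subst nn_integral_cmult) (auto intro!: mult_left_mono holder)
    also have "\<dots> = ennreal (K * C) * ennreal (norm (weighted \<rho> \<psi> z))"
      using K0 C0 by (simp add: ennreal_mult'[symmetric] mult_ac)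
    finally show ?thesis .
  qed
  \<comment> \<open>Tonelli is used twice: first to integrate over \<open>b\<close> at fixed
    \<open>a\<close>, as \<open>slice\<close> requires, then to invert \<open>a\<close> at fixed
    \<open>z\<close>.\<close>
  have "(\<integral>\<^sup>+b. \<integral>\<^sup>+a. ennreal (norm (basic_integrand \<alpha> \<rho> \<phi> \<psi> chi u v w a b)) \<partial>lborel \<partial>lborel)
      = (\<integral>\<^sup>+a. \<integral>\<^sup>+b. ennreal (norm (basic_integrand \<alpha> \<rho> \<phi> \<psi> chi u v w a b)) \<partial>lborel \<partial>lborel)"
    unfolding norm_basic_integrand by (intro lborel_pair.Fubini') measurable
  also have "\<dots> = (\<integral>\<^sup>+a. \<integral>\<^sup>+z. ennreal (1 / a\<^sup>2) * G z (1 / a) \<partial>lborel \<partial>lborel)"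
    by (simp only: slice)
  also have "\<dots> = (\<integral>\<^sup>+z. \<integral>\<^sup>+a. ennreal (1 / a\<^sup>2) * G z (1 / a) \<partial>lborel \<partial>lborel)"
    by (intro lborel_pair.Fubini') measurable
  also have "\<dots> = (\<integral>\<^sup>+z. \<integral>\<^sup>+s. G z s \<partial>lborel \<partial>lborel)"
    by (intro nn_integral_cong nn_integral_inverse[symmetric]) measurable
  also have "\<dots> \<le> (\<integral>\<^sup>+z. ennreal (K * C) * ennreal (norm (weighted \<rho> \<psi> z)) \<partial>lborel)"
    by (intro nn_integral_mono inner)
  also have "\<dots> = ennreal (K * C) * ennreal (Lp_norm 1 (weighted \<rho> \<psi>))"
    using nn_integral_norm_in_L1[OF \<psi>] by (subst nn_integral_cmult) (simp_all add: nn_integral_completion)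
  also have "\<dots> = ennreal (K * C * Lp_norm 1 (weighted \<rho> \<psi>))"
    using K0 C0 by (simp add: ennreal_mult')
  also have "K * C * Lp_norm 1 (weighted \<rho> \<psi>)
    = 2 powr \<rho> * \<bar>v - w\<bar> powr (- enn2real (1 / q)) * \<bar>u - w\<bar> powr (- enn2real (1 / p) - \<rho>)
        * Lp_norm q chi * Lp_norm p (weighted \<rho> \<phi>) * Lp_norm 1 (weighted \<rho> \<psi>)"
  proof -
    have "\<bar>u - w\<bar> powr (- enn2real (1 / p) - \<rho>) = \<bar>u - w\<bar> powr (- enn2real (1 / p)) * \<bar>u - w\<bar> powr (- \<rho>)"
      by (simp add: powr_add[symmetric])
    then show ?thesis by (simp add: K_def C_def mult_ac)
  qed
  finally show ?thesis .
qed

section \<open>Fubini's theorem, the passage to Lebesgue measurable functions, and the basic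
  function\<close>

text \<open>By Tonelli the finite bound is an L^1 bound on the product measure; Fubini then yields
  both levels of integrability, and the modulus of the integral is at most the L^1 norm.\<close>

lemma iterated_lborel_integral_bound:
  fixes F :: "real \<Rightarrow> real \<Rightarrow> 'a::{banach, second_countable_topology}"
  assumes F: "(\<lambda>(b, a). F b a) \<in> borel_measurable (borel \<Otimes>\<^sub>M borel)"
    and le: "(\<integral>\<^sup>+b. \<integral>\<^sup>+a. ennreal (norm (F b a)) \<partial>lborel \<partial>lborel) \<le> ennreal B" and B: "0 \<le> B"
  shows "AE b in lborel. integrable lborel (F b)"
    and "integrable lborel (\<lambda>b. LINT a|lborel. F b a)"
    and "norm (LINT b|lborel. LINT a|lborel. F b a) \<le> B"
proof -
  have [measurable]: "(\<lambda>(b, a). F b a) \<in> borel_measurable (lborel \<Otimes>\<^sub>M lborel)"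
    using F by (simp cong: measurable_cong_sets sets_pair_measure_cong)
  have eq: "(\<integral>\<^sup>+x. ennreal (norm (case x of (b, a) \<Rightarrow> F b a)) \<partial>(lborel \<Otimes>\<^sub>M lborel))
      = (\<integral>\<^sup>+b. \<integral>\<^sup>+a. ennreal (norm (F b a)) \<partial>lborel \<partial>lborel)"
    by (subst lborel.nn_integral_fst[symmetric]) simp_all
  also have "\<dots> < \<infinity>" using le by (rule le_less_trans) simp
  finally have int: "integrable (lborel \<Otimes>\<^sub>M lborel) (\<lambda>(b, a). F b a)"
    by (simp add: integrable_iff_bounded)
  show "AE b in lborel. integrable lborel (F b)"
    using lborel_pair.AE_integrable_fst[OF int] by simp
  show "integrable lborel (\<lambda>b. LINT a|lborel. F b a)"
    using lborel_pair.integrable_fst[OF int] by simp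
  have "(LINT b|lborel. LINT a|lborel. F b a) = integral\<^sup>L (lborel \<Otimes>\<^sub>M lborel) (\<lambda>(b, a). F b a)"
    by (rule lborel_pair.integral_fst[OF int])
  also have "ennreal (norm \<dots>) \<le> (\<integral>\<^sup>+x. ennreal (norm (case x of (b, a) \<Rightarrow> F b a)) \<partial>(lborel \<Otimes>\<^sub>M lborel))"
    by (rule integral_norm_bound_ennreal[OF int])
  also have "\<dots> \<le> ennreal B" unfolding eq by (rule le)
  finally show "norm (LINT b|lborel. LINT a|lborel. F b a) \<le> B"
    using B by simp
qed

text \<open>For \<open>b\<close> equal to \<open>u\<close>, \<open>v\<close> or \<open>w\<close> one
  argument would be constantly 0, a point at which almost everywhere equality says nothing. For
  every other \<open>b\<close> all three numerators are nonzero and inversion preserves the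
  equalities.\<close>

lemma AE_basic_integrand_cong:
  assumes "AE x in lborel. \<phi> x = \<phi>' x" "AE x in lborel. \<psi> x = \<psi>' x" "AE x in lborel. chi x = chi' x"
  shows "AE b in lborel. AE a in lborel.
    basic_integrand \<alpha> \<rho> \<phi> \<psi> chi u v w a b = basic_integrand \<alpha> \<rho> \<phi>' \<psi>' chi' u v w a b"
  using AE_lborel_singleton[of u] AE_lborel_singleton[of v] AE_lborel_singleton[of w]
proof eventually_elim
  case (elim b)
  have "AE a in lborel. \<phi> ((u - b) / a) = \<phi>' ((u - b) / a)"
    by (rule AE_lborel_inverse[OF assms(1)]) (use elim in auto)
  moreover have "AE a in lborel. \<psi> ((w - b) / a) = \<psi>' ((w - b) / a)"
    by (rule AE_lborel_inverse[OF assms(2)]) (use elim in auto)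
  moreover have "AE a in lborel. chi ((v - b) / a) = chi' ((v - b) / a)"
    by (rule AE_lborel_inverse[OF assms(3)]) (use elim in auto)
  ultimately show ?case
    by eventually_elim (simp add: basic_integrand_def daughter_def)
qed

lemma basic_function_bound:
  fixes \<phi> \<psi> chi :: "real \<Rightarrow> complex"
  assumes \<rho>: "0 \<le> \<rho>" and pq: "1 \<le> p" "1 \<le> q" "1 / p + 1 / q = 1"
    and meas: "\<phi> \<in> borel_measurable lebesgue" "\<psi> \<in> borel_measurable lebesgue"
      "chi \<in> borel_measurable lebesgue"
    and \<phi>: "in_Lp p (weighted \<rho> \<phi>)" and chi: "in_Lp q chi" and \<psi>: "in_Lp 1 (weighted \<rho> \<psi>)"
    and ne: "v \<noteq> w" "u \<noteq> w"
  shows "basic_function_defined \<alpha> \<rho> \<phi> \<psi> chi u v w"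
    and "norm (LINT b|lebesgue. LINT a|lebesgue. basic_integrand \<alpha> \<rho> \<phi> \<psi> chi u v w a b)
      \<le> 2 powr \<rho> * \<bar>v - w\<bar> powr (- enn2real (1 / q)) * \<bar>u - w\<bar> powr (- enn2real (1 / p) - \<rho>)
        * Lp_norm q chi * Lp_norm p (weighted \<rho> \<phi>) * Lp_norm 1 (weighted \<rho> \<psi>)" (is "_ \<le> ?B")
proof -
  obtain \<phi>' where \<phi>' [measurable]: "\<phi>' \<in> borel_measurable borel" and \<phi>_eq: "AE x in lborel. \<phi> x = \<phi>' x"
    using lebesgue_ex_borel_complex[OF meas(1)] .
  obtain \<psi>' where \<psi>' [measurable]: "\<psi>' \<in> borel_measurable borel" and \<psi>_eq: "AE x in lborel. \<psi> x = \<psi>' x"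
    using lebesgue_ex_borel_complex[OF meas(2)] .
  obtain chi' where chi' [measurable]: "chi' \<in> borel_measurable borel" and chi_eq: "AE x in lborel. chi x = chi' x"
    using lebesgue_ex_borel_complex[OF meas(3)] .
  have w\<phi>: "AE x in lborel. weighted \<rho> \<phi> x = weighted \<rho> \<phi>' x"
    using \<phi>_eq by eventually_elim (simp add: weighted_def)
  have w\<psi>: "AE x in lborel. weighted \<rho> \<psi> x = weighted \<rho> \<psi>' x"
    using \<psi>_eq by eventually_elim (simp add: weighted_def)
  let ?F = "\<lambda>b a. basic_integrand \<alpha> \<rho> \<phi> \<psi> chi u v w a b"
  let ?G = "\<lambda>b a. basic_integrand \<alpha> \<rho> \<phi>' \<psi>' chi' u v w a b"
  have G: "(\<lambda>(b, a). ?G b a) \<in> borel_measurable (borel \<Otimes>\<^sub>M borel)"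
    by (intro basic_integrand_borel_measurable) measurable
  have "(\<integral>\<^sup>+b. \<integral>\<^sup>+a. ennreal (norm (?G b a)) \<partial>lborel \<partial>lborel) \<le> ennreal ?B"
    using nn_integral_basic_integrand_le[OF \<rho> pq \<phi>' \<psi>' chi' in_Lp_cong_AE[OF \<phi> w\<phi>]
        in_Lp_cong_AE[OF chi chi_eq] in_Lp_cong_AE[OF \<psi> w\<psi>] ne]
    by (simp only: Lp_norm_cong_AE[OF \<phi> w\<phi>] Lp_norm_cong_AE[OF chi chi_eq] Lp_norm_cong_AE[OF \<psi> w\<psi>])
  moreover have "0 \<le> ?B" by (simp add: Lp_norm_nonneg)
  ultimately have int: "AE b in lborel. integrable lborel (?G b)"
      "integrable lborel (\<lambda>b. LINT a|lborel. ?G b a)"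
    and bound: "norm (LINT b|lborel. LINT a|lborel. ?G b a) \<le> ?B"
    by (rule iterated_lborel_integral_bound[OF G])+
  have G_sec [measurable]: "?G b \<in> borel_measurable borel" for b
    using measurable_compose[OF measurable_Pair1' G, of b] by simp
  have ae: "AE b in lborel. AE a in lborel. ?F b a = ?G b a"
    by (rule AE_basic_integrand_cong[OF \<phi>_eq \<psi>_eq chi_eq])
  \<comment> \<open>For almost every \<open>b\<close> the section of the original integrand agrees
    almost everywhere with a Borel one, so completeness makes it measurable.\<close>
  have inner: "AE b in lborel. integrable lebesgue (?F b) \<and> (LINT a|lebesgue. ?F b a) = (LINT a|lborel. ?G b a)"
    using ae int(1)
  proof eventually_elim
    case (elim b)
    have eq: "AE a in lebesgue. ?G b a = ?F b a"
      using AE_completion[OF elim(1)] by eventually_elim simp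
    have Gm: "?G b \<in> borel_measurable lebesgue" by (intro measurable_completion) simp
    have Fm: "?F b \<in> borel_measurable lebesgue" by (rule borel_measurable_AE[OF Gm eq])
    show ?case
      using integrable_cong_AE[OF Gm Fm eq] integral_cong_AE[OF Gm Fm eq] elim(2)
      by (simp add: integrable_completion integral_completion)
  qed
  have eq: "AE b in lebesgue. (LINT a|lborel. ?G b a) = (LINT a|lebesgue. ?F b a)"
    using AE_completion[OF inner] by eventually_elim simp
  have Gm: "(\<lambda>b. LINT a|lborel. ?G b a) \<in> borel_measurable lborel"
    using int(2) by (rule borel_measurable_integrable)
  have Gm': "(\<lambda>b. LINT a|lborel. ?G b a) \<in> borel_measurable lebesgue"
    by (rule measurable_completion[OF Gm])
  \<comment> \<open>Measurability in \<open>b\<close> is inherited in the same way from the Borel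
    version, so joint measurability of the original integrand never enters.\<close>
  have Fm: "(\<lambda>b. LINT a|lebesgue. ?F b a) \<in> borel_measurable lebesgue"
    by (rule borel_measurable_AE[OF Gm' eq])
  have "AE b in lebesgue. integrable lebesgue (?F b)"
    using AE_completion[OF inner] by eventually_elim simp
  moreover have "integrable lebesgue (\<lambda>b. LINT a|lebesgue. ?F b a)"
    using integrable_cong_AE[OF Gm' Fm eq] int(2) integrable_completion[OF Gm] by simp
  ultimately show "basic_function_defined \<alpha> \<rho> \<phi> \<psi> chi u v w"
    by (simp add: basic_function_defined_def)
  have "(LINT b|lebesgue. LINT a|lebesgue. ?F b a) = (LINT b|lborel. LINT a|lborel. ?G b a)"
    using integral_cong_AE[OF Gm' Fm eq] integral_completion[OF Gm] by simp
  with bound show "norm (LINT b|lebesgue. LINT a|lebesgue. ?F b a) \<le> ?B" by simp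
qed

theorem theorem3p1:
  fixes \<alpha> \<rho> :: real and p q :: ennreal and \<phi> \<psi> chi :: "real \<Rightarrow> complex" and u v w :: real
  assumes "sin (\<alpha> * pi / 2) \<noteq> 0"
    and "\<rho> \<ge> 0"
    and "1 \<le> p" and "1 \<le> q" and "1 / p + 1 / q = 1"
    and "\<phi> \<in> borel_measurable lebesgue"
    and "\<psi> \<in> borel_measurable lebesgue"
    and "chi \<in> borel_measurable lebesgue"
    and "in_Lp p (weighted \<rho> \<phi>)"
    and "in_Lp q chi"
    and "in_Lp 1 (weighted \<rho> \<psi>)"
    and "in_Lp 2 \<phi>"
    and "0 < admissibility_const \<phi>" and "admissibility_const \<phi> < \<infinity>"
    and "v \<noteq> w" and "u \<noteq> w"
  shows "basic_function_defined \<alpha> \<rho> \<phi> \<psi> chi u v w \<and>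
    norm (basic_function \<alpha> \<rho> \<phi> \<psi> chi u v w)
      \<le> 2 powr (\<rho> + enn2real (1 / p)) * inverse (enn2real (admissibility_const \<phi>))
        * \<bar>v - w\<bar> powr (- enn2real (1 / q)) * \<bar>u - w\<bar> powr (- enn2real (1 / p) - \<rho>)
        * Lp_norm q chi * Lp_norm p (weighted \<rho> \<phi>) * Lp_norm 1 (weighted \<rho> \<psi>)"
proof
  note bound = basic_function_bound[OF assms(2-11,15,16), of \<alpha>]
  show "basic_function_defined \<alpha> \<rho> \<phi> \<psi> chi u v w" by (rule bound)
  let ?C = "inverse (enn2real (admissibility_const \<phi>))"
  let ?R = "\<bar>v - w\<bar> powr (- enn2real (1 / q)) * \<bar>u - w\<bar> powr (- enn2real (1 / p) - \<rho>)
        * Lp_norm q chi * Lp_norm p (weighted \<rho> \<phi>) * Lp_norm 1 (weighted \<rho> \<psi>)"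
  have "norm (basic_function \<alpha> \<rho> \<phi> \<psi> chi u v w) \<le> ?C * (2 powr \<rho> * ?R)"
    unfolding basic_function_def norm_mult
    using mult_left_mono[OF bound(2), of ?C] by (simp add: mult.assoc norm_inverse)
  \<comment> \<open>As 1/p is nonnegative and the base 2 exceeds 1, raising the exponent to \<rho> +
    1/p gives the stated constant.\<close>
  also have "\<dots> \<le> ?C * (2 powr (\<rho> + enn2real (1 / p)) * ?R)"
    by (intro mult_left_mono mult_right_mono powr_mono) (simp_all add: Lp_norm_nonneg)
  finally show "norm (basic_function \<alpha> \<rho> \<phi> \<psi> chi u v w)
      \<le> 2 powr (\<rho> + enn2real (1 / p)) * ?C
        * \<bar>v - w\<bar> powr (- enn2real (1 / q)) * \<bar>u - w\<bar> powr (- enn2real (1 / p) - \<rho>)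
        * Lp_norm q chi * Lp_norm p (weighted \<rho> \<phi>) * Lp_norm 1 (weighted \<rho> \<psi>)"
    by (simp only: mult_ac)
qed

end
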